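(* Let $0<\tau<\infty$ and $0<q\le\infty$, and assume $\{Q_\xi:\xi\in\mathcal X\}$ is a nested structure associated with $\mathcal X$. Then for any $n\in\mathbb N$ and any sequence $h=\{h_\xi\}_{\xi\in\mathcal X}$ with at most $n$ non-zero elements we have $$\|h\|_{\ell^\tau}\le n^{1/\tau}\|h\|_{\mathfrak g^q}.$$
   Context: Nested structure. Let $\mathcal X$ be a countable multilevel index set, $\mathcal X=\bigcup_{n=0}^\infty\mathcal X_n$ or $\mathcal X=\bigcup_{n=-\infty}^\infty\mathcal X_n$ (disjoint levels), and let $\mathfrak D$ be a measurable domain (a topological space with a Borel measure $|\cdot|$). To each $\xi\in\mathcal X$ an open set $Q_\xi\subset\mathfrak D$ with $0<|Q_\xi|<\infty$ is associated. $\{Q_\xi:\xi\in\mathcal X\}$ is a nested structure associated with $\mathcal X$ if there is a constant $\kappa\ge1$ such that: (1) $|\mathfrak D\setminus\bigcup_{\xi\in\mathcal X_n}Q_\xi|=0$ for all levels $n$; (2) if $\eta\in\mathcal X_m$, $\xi\in\mathcal X_n$ and $m\ge n$, then either $Q_\eta\subset Q_\xi$ or $Q_\eta\cap Q_\xi=\emptyset$; (3) for every $\xi\in\mathcal X_n$ and $m<n$ there exists a unique $\eta\in\mathcal X_m$ such that $Q_\xi\subset Q_\eta$; (4) $|Q_\eta|\le\kappa|Q_\zeta|$ for all $\eta,\zeta\in\mathcal X_n$ and all levels $n$; (5) every $Q_\xi$, $\xi\in\mathcal X_n$, has at least two children, i.e. there exist $\eta\ne\zeta$ in $\mathcal X_{n+1}$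 with $Q_\eta\subset Q_\xi$, $Q_\zeta\subset Q_\xi$. If $\mathcal X=\bigcup_{n=0}^\infty\mathcal X_n$ it is also assumed that $\mathcal X_0=\{\xi_0\}$ is a single element and $Q_{\xi_0}$ is the interior of $\mathfrak D$. If $\mathcal X=\bigcup_{n=-\infty}^\infty\mathcal X_n$ it is also assumed that there are finitely many mutually disjoint open sets $\mathfrak D^1,\dots,\mathfrak D^J\subset\mathfrak D$ such that (i) $|\mathfrak D\setminus\bigcup_j\mathfrak D^j|=0$; (ii) every $Q_\xi$ is contained in some $\mathfrak D^j$; (iii) if $Q_\xi,Q_\eta\subset\mathfrak D^j$ for some $j$, then there is $Q_\zeta\subset\mathfrak D^j$ with $Q_\xi\subset Q_\zeta$, $Q_\eta\subset Q_\zeta$. For complex sequences $h=\{h_\xi\}_{\xi\in\mathcal X}$: $\|h\|_{\ell^\tau}=(\sum_{\xi}|h_\xi|^\tau)^{1/\tau}$ and $\|h\|_{\mathfrak g^q}=\sup_{\xi\in\mathcal X}\big(\sum_{\eta:\,Q_\eta\subset Q_\xi}|h_\eta|^q\frac{|Q_\eta|}{|Q_\xi|}\big)^{1/q}$ for $q<\infty$, $\|h\|_{\mathfrak g^\infty}=\sup_\xi|h_\xi|$. *)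

theory Defs
  imports "HOL-Analysis.Analysis"
begin

(* The domain D is a subset of an ambient topological space, because the axioms refer to the
   interior of D; taking D = UNIV gives the intrinsic reading. The measure |.| lives on the Borel
   sets of the subspace D. *)
definition measurable_domain :: "'a::topological_space set \<Rightarrow> 'a measure \<Rightarrow> bool" where
  "measurable_domain D M \<longleftrightarrow> space M = D \<and> sets M = sets (restrict_space borel D)"

(* L is the set of levels and X n is the n-th level; X n is irrelevant for n outside L. *)
definition index_set :: "int set \<Rightarrow> (int \<Rightarrow> 'i set) \<Rightarrow> 'i set" where
  "index_set L X = (\<Union>n\<in>L. X n)"

definition multilevel :: "int set \<Rightarrow> (int \<Rightarrow> 'i set) \<Rightarrow> bool" where
  "multilevel L X \<longleftrightarrow>
     (L = {0..} \<or> L = UNIV) \<and> countable (index_set L X) \<and> disjoint_family_on X L"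

definition nested_conditions ::
  "int set \<Rightarrow> (int \<Rightarrow> 'i set) \<Rightarrow> 'a::topological_space set \<Rightarrow> 'a measure \<Rightarrow> ('i \<Rightarrow> 'a set) \<Rightarrow> real \<Rightarrow> bool" where
  "nested_conditions L X D M Q \<kappa> \<longleftrightarrow>
     (\<forall>n\<in>L. emeasure M (D - (\<Union>\<xi>\<in>X n. Q \<xi>)) = 0) \<and>
     (\<forall>m\<in>L. \<forall>n\<in>L. \<forall>\<eta>\<in>X m. \<forall>\<xi>\<in>X n. m \<ge> n \<longrightarrow> Q \<eta> \<subseteq> Q \<xi> \<or> Q \<eta> \<inter> Q \<xi> = {}) \<and>
     (\<forall>n\<in>L. \<forall>\<xi>\<in>X n. \<forall>m\<in>L. m < n \<longrightarrow> (\<exists>!\<eta>. \<eta> \<in> X m \<and> Q \<xi> \<subseteq> Q \<eta>)) \<and>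
     (\<forall>n\<in>L. \<forall>\<eta>\<in>X n. \<forall>\<zeta>\<in>X n. emeasure M (Q \<eta>) \<le> ennreal \<kappa> * emeasure M (Q \<zeta>)) \<and>
     (\<forall>n\<in>L. \<forall>\<xi>\<in>X n. \<exists>\<eta>\<in>X (n + 1). \<exists>\<zeta>\<in>X (n + 1). \<eta> \<noteq> \<zeta> \<and> Q \<eta> \<subseteq> Q \<xi> \<and> Q \<zeta> \<subseteq> Q \<xi>)"

definition root_condition ::
  "(int \<Rightarrow> 'i set) \<Rightarrow> 'a::topological_space set \<Rightarrow> ('i \<Rightarrow> 'a set) \<Rightarrow> bool" where
  "root_condition X D Q \<longleftrightarrow> (\<exists>\<xi>\<^sub>0. X 0 = {\<xi>\<^sub>0} \<and> Q \<xi>\<^sub>0 = interior D)"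

definition component_condition ::
  "int set \<Rightarrow> (int \<Rightarrow> 'i set) \<Rightarrow> 'a::topological_space set \<Rightarrow> 'a measure \<Rightarrow> ('i \<Rightarrow> 'a set) \<Rightarrow> bool" where
  "component_condition L X D M Q \<longleftrightarrow>
     (\<exists>(J::nat) (DD :: nat \<Rightarrow> 'a set).
        (\<forall>j\<in>{1..J}. open (DD j) \<and> DD j \<subseteq> D) \<and>
        disjoint_family_on DD {1..J} \<and>
        emeasure M (D - (\<Union>j\<in>{1..J}. DD j)) = 0 \<and>
        (\<forall>\<xi>\<in>index_set L X. \<exists>j\<in>{1..J}. Q \<xi> \<subseteq> DD j) \<and>
        (\<forall>j\<in>{1..J}. \<forall>\<xi>\<in>index_set L X. \<forall>\<eta>\<in>index_set L X.
           Q \<xi> \<subseteq> DD j \<and> Q \<eta> \<subseteq> DD j \<longrightarrow>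
           (\<exists>\<zeta>\<in>index_set L X. Q \<zeta> \<subseteq> DD j \<and> Q \<xi> \<subseteq> Q \<zeta> \<and> Q \<eta> \<subseteq> Q \<zeta>)))"

definition nested_structure ::
  "int set \<Rightarrow> (int \<Rightarrow> 'i set) \<Rightarrow> 'a::topological_space set \<Rightarrow> 'a measure \<Rightarrow> ('i \<Rightarrow> 'a set) \<Rightarrow> bool" where
  "nested_structure L X D M Q \<longleftrightarrow>
     measurable_domain D M \<and> multilevel L X \<and>
     (\<forall>\<xi>\<in>index_set L X. open (Q \<xi>) \<and> Q \<xi> \<subseteq> D \<and> 0 < emeasure M (Q \<xi>) \<and> emeasure M (Q \<xi>) < \<infinity>) \<and>
     (\<exists>\<kappa>\<ge>1. nested_conditions L X D M Q \<kappa>) \<and>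
     (L = {0..} \<longrightarrow> root_condition X D Q) \<and>
     (L = UNIV \<longrightarrow> component_condition L X D M Q)"

(* Power with real exponent a > 0 on [0,\<infinity>]. *)
definition ennreal_powr :: "ennreal \<Rightarrow> real \<Rightarrow> ennreal" where
  "ennreal_powr x a = (if x = \<infinity> then \<infinity> else ennreal (enn2real x powr a))"

(* Both (quasi-)norms take values in [0,\<infinity>], so the sums and suprema always exist. *)
definition ell_norm :: "real \<Rightarrow> 'i set \<Rightarrow> ('i \<Rightarrow> complex) \<Rightarrow> ennreal" where
  "ell_norm \<tau> I h = ennreal_powr (\<Sum>\<^sub>\<infinity>\<xi>\<in>I. ennreal (cmod (h \<xi>) powr \<tau>)) (1 / \<tau>)"

definition g_norm ::
  "ennreal \<Rightarrow> 'i set \<Rightarrow> 'a measure \<Rightarrow> ('i \<Rightarrow> 'a set) \<Rightarrow> ('i \<Rightarrow> complex) \<Rightarrow> ennreal" where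
  "g_norm q I M Q h =
     (if q = \<infinity> then (SUP \<xi>\<in>I. ennreal (cmod (h \<xi>)))
      else (SUP \<xi>\<in>I. ennreal_powr
              (\<Sum>\<^sub>\<infinity>\<eta>\<in>{\<eta>\<in>I. Q \<eta> \<subseteq> Q \<xi>}.
                 ennreal (cmod (h \<eta>) powr enn2real q) * (emeasure M (Q \<eta>) / emeasure M (Q \<xi>)))
              (1 / enn2real q)))"

end

theory Submission
  imports Defs
begin

text \<open>
  The inequality holds because \<^term>\<open>g_norm q I M Q h\<close> dominates every single entry of \<open>h\<close>
  in absolute value. For \<open>q = \<infinity>\<close> this is the definition; for \<open>q < \<infinity>\<close> the sum attached to
  \<open>\<xi>\<close> contains the term \<open>\<eta> = \<xi>\<close>, whose weight \<open>|Q \<xi>| / |Q \<xi>|\<close> equals \<open>1\<close> since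
  \<open>0 < |Q \<xi>| < \<infinity>\<close>, and all other terms are non-negative (lemma \<open>cmod_le_g_norm\<close>).
  An \<open>\<ell>\<^sup>\<tau>\<close>-sum with at most \<open>n\<close> non-zero entries, each bounded by \<open>G\<close>, is at most
  \<open>n G\<^sup>\<tau>\<close>, and taking the \<open>\<tau>\<close>-th root gives the claim
  (lemma \<open>ell_norm_le_card_powr_mult_bound\<close>).
\<close>

lemma ennreal_powr_ennreal:
  "0 \<le> x \<Longrightarrow> ennreal_powr (ennreal x) a = ennreal (x powr a)"
  by (simp add: ennreal_powr_def)

lemma ennreal_powr_mono:
  assumes "0 \<le> a" and "x \<le> y"
  shows "ennreal_powr x a \<le> ennreal_powr y a"
proof (cases "y = \<infinity>")
  case True
  then show ?thesis by (simp add: ennreal_powr_def)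
next
  case False
  then have "x \<noteq> \<infinity>" "enn2real x \<le> enn2real y"
    using assms by (auto simp: top_unique less_top intro!: enn2real_mono)
  with False assms show ?thesis
    by (auto simp: ennreal_powr_def intro!: ennreal_leI powr_mono2)
qed

text \<open>
  The inclusion \<open>Q \<xi> \<subseteq> Q \<xi>\<close> puts \<open>\<xi>\<close> itself among the indices summed over. Positivity and
  finiteness of its measure exclude the quotients \<open>0 / 0\<close> and \<open>\<infinity> / \<infinity>\<close>, which are
  \<open>0\<close> in \<^typ>\<open>ennreal\<close>.
\<close>

lemma cmod_le_g_norm:
  assumes "0 < q" and \<xi>: "\<xi> \<in> I"
    and pos: "0 < emeasure M (Q \<xi>)" and fin: "emeasure M (Q \<xi>) < \<infinity>"
  shows "ennreal (cmod (h \<xi>)) \<le> g_norm q I M Q h"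
proof (cases "q = \<infinity>")
  case True
  then show ?thesis
    using \<xi> by (auto simp: g_norm_def intro!: SUP_upper)
next
  case False
  define p where "p = enn2real q"
  have "0 < p"
    using \<open>0 < q\<close> False by (simp add: p_def enn2real_positive_iff less_top)
  let ?term = "\<lambda>\<eta>. ennreal (cmod (h \<eta>) powr p) * (emeasure M (Q \<eta>) / emeasure M (Q \<xi>))"
  let ?below = "{\<eta> \<in> I. Q \<eta> \<subseteq> Q \<xi>}"
  have "ennreal (cmod (h \<xi>) powr p) = ?term \<xi>"
    using pos fin by (simp add: ennreal_divide_self)
  also have "\<dots> = (\<Sum>\<^sub>\<infinity>\<eta>\<in>{\<xi>}. ?term \<eta>)"
    by simp
  also have "\<dots> \<le> (\<Sum>\<^sub>\<infinity>\<eta>\<in>?below. ?term \<eta>)"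
    by (rule infsum_mono_neutral) (use \<xi> in \<open>auto intro: nonneg_summable_on_complete\<close>)
  finally have "ennreal_powr (ennreal (cmod (h \<xi>) powr p)) (1 / p)
      \<le> ennreal_powr (\<Sum>\<^sub>\<infinity>\<eta>\<in>?below. ?term \<eta>) (1 / p)"
    using \<open>0 < p\<close> by (intro ennreal_powr_mono) auto
  also have "\<dots> \<le> g_norm q I M Q h"
    using False \<xi> unfolding g_norm_def p_def by (auto intro: SUP_upper)
  finally show ?thesis
    using \<open>0 < p\<close> by (simp add: ennreal_powr_ennreal powr_powr)
qed

lemma ell_norm_le_card_powr_mult_bound:
  assumes "0 < \<tau>"
    and fin: "finite {\<xi> \<in> I. h \<xi> \<noteq> 0}" and card: "card {\<xi> \<in> I. h \<xi> \<noteq> 0} \<le> n"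
    and bound: "\<And>\<xi>. \<xi> \<in> I \<Longrightarrow> cmod (h \<xi>) \<le> G" and "0 \<le> G"
  shows "ell_norm \<tau> I h \<le> ennreal (real n powr (1 / \<tau>)) * ennreal G"
proof -
  let ?S = "{\<xi> \<in> I. h \<xi> \<noteq> 0}"
  have "(\<Sum>\<^sub>\<infinity>\<xi>\<in>I. ennreal (cmod (h \<xi>) powr \<tau>)) = (\<Sum>\<^sub>\<infinity>\<xi>\<in>?S. ennreal (cmod (h \<xi>) powr \<tau>))"
    by (rule infsum_cong_neutral) auto
  also have "\<dots> = (\<Sum>\<xi>\<in>?S. ennreal (cmod (h \<xi>) powr \<tau>))"
    using fin by simp
  also have "\<dots> = ennreal (\<Sum>\<xi>\<in>?S. cmod (h \<xi>) powr \<tau>)"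
    by (simp add: sum_ennreal)
  also have "\<dots> \<le> ennreal (real n * G powr \<tau>)"
  proof (rule ennreal_leI)
    have "(\<Sum>\<xi>\<in>?S. cmod (h \<xi>) powr \<tau>) \<le> real (card ?S) * G powr \<tau>"
      using \<open>0 < \<tau>\<close> bound by (intro sum_bounded_above powr_mono2) auto
    also have "\<dots> \<le> real n * G powr \<tau>"
      using card by (intro mult_right_mono) auto
    finally show "(\<Sum>\<xi>\<in>?S. cmod (h \<xi>) powr \<tau>) \<le> real n * G powr \<tau>" .
  qed
  finally have "ell_norm \<tau> I h \<le> ennreal_powr (ennreal (real n * G powr \<tau>)) (1 / \<tau>)"
    unfolding ell_norm_def using \<open>0 < \<tau>\<close> by (intro ennreal_powr_mono) auto
  also have "\<dots> = ennreal (real n powr (1 / \<tau>)) * ennreal G"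
    using \<open>0 < \<tau>\<close> \<open>0 \<le> G\<close>
    by (simp add: ennreal_powr_ennreal powr_mult powr_powr flip: ennreal_mult)
  finally show ?thesis .
qed

theorem theorem7p8:
  fixes \<tau> :: real and q :: ennreal
    and L :: "int set" and X :: "int \<Rightarrow> 'i set"
    and D :: "'a::topological_space set" and M :: "'a measure" and Q :: "'i \<Rightarrow> 'a set"
    and n :: nat and h :: "'i \<Rightarrow> complex"
  assumes "0 < \<tau>" and "0 < q"
    and "nested_structure L X D M Q"
    and "finite {\<xi> \<in> index_set L X. h \<xi> \<noteq> 0}"
    and "card {\<xi> \<in> index_set L X. h \<xi> \<noteq> 0} \<le> n"
  shows "ell_norm \<tau> (index_set L X) h
           \<le> ennreal (real n powr (1 / \<tau>)) * g_norm q (index_set L X) M Q h"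
proof -
  let ?I = "index_set L X"
  have entry: "ennreal (cmod (h \<xi>)) \<le> g_norm q ?I M Q h" if "\<xi> \<in> ?I" for \<xi>
    using assms(2,3) that by (intro cmod_le_g_norm) (auto simp: nested_structure_def)
  show ?thesis
  proof (cases "g_norm q ?I M Q h")
    case (real G)
    then have "cmod (h \<xi>) \<le> G" if "\<xi> \<in> ?I" for \<xi>
      using entry[OF that] by (simp add: ennreal_le_iff)
    then show ?thesis
      using ell_norm_le_card_powr_mult_bound[OF assms(1,4,5)] real by simp
  next
    case top
    show ?thesis
    proof (cases "n = 0")
      case True
      \<comment> \<open>As \<open>0 powr a = 0\<close> and \<open>0 * \<infinity> = 0\<close>, the right-hand side is \<open>0\<close> and the infinite
          norm gives nothing; but then \<open>h\<close> vanishes, so \<open>0\<close> is a bound for its entries.\<close>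
      then have "h \<xi> = 0" if "\<xi> \<in> ?I" for \<xi>
        using assms(4,5) that by auto
      then show ?thesis
        using ell_norm_le_card_powr_mult_bound[OF assms(1,4,5), of 0] by simp
    next
      case False
      then show ?thesis
        using top by (simp add: ennreal_mult_top)
    qed
  qed
qed

end
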